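(* Let $M\ge 1$ be an integer and $\delta\in[0,1]$. Consider any hidden-variable (HV) model for settings $x,y\in\{0,1,\dots,M\}$ and outcomes $a,b\in\{0,1\}$ that satisfies measurement independence and parameter independence and is $\delta$-outcome dependent. Let $p(a,b\mid x,y)$ be the correlation it produces, and suppose that $$p(0,0\mid 0,0)=0,\qquad p(0,1\mid k,k-1)=0,\qquad p(1,0\mid k-1,k)=0\qquad\text{for all }k\in\{1,\dots,M\}.$$ Then $$p_H^M:=p(0,0\mid M,M)\ \le\ \frac{\delta^{q}}{2},\qquad q=\frac{M+1}{2}.$$
   Context: HV model with measurement independence (MI): a probability space $(\Lambda,\mu)$ of hidden variables $\lambda$ whose distribution does not depend on the settings, and for each $\lambda,x,y$ a probability distribution $p(a,b\mid\lambda,x,y)$ on pairs of outcomes (measurable in $\lambda$). The correlation produced is $p(a,b\mid x,y)=\int p(a,b\mid\lambda,x,y)\,d\mu(\lambda)$. In $p(a,b\mid x,y)$, $a$ and $x$ are Alice's outcome and setting, and $b$ and $y$ are Bob's. Parameter independence (PI): for every $\lambda$, the marginal $p(a\mid\lambda,x,y)=\sum_b p(a,b\mid\lambda,x,y)$ does not depend on $y$, and the marginal $p(b\mid\lambda,x,y)=\sum_a p(a,b\mid\lambda,x,y)$ does not depend on $x$. $\delta$-outcome dependent ($\delta$-OD): for all $\lambda,x,y$ and all $a,a'$ (with $p(a\mid\lambda,x,y)>0$ and $p(a'\mid\lambda,x,y)>0$, so that the conditional probabilities $p(b\mid\lambda,x,y,a)=p(a,b\mid\lambda,x,y)/p(a\mid\lambda,x,y)$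 are defined), $\frac12\sum_b|p(b\mid\lambda,x,y,a)-p(b\mid\lambda,x,y,a')|\le\delta$. *)

theory Defs
  imports "HOL-Probability.Probability" "HOL-Library.Numeral_Type"
begin

text \<open>
  \<open>P l x y\<close> is the joint distribution of the outcome pair (a, b) given the hidden variable \<open>l\<close> and
  the settings \<open>x \<in> X\<close>, \<open>y \<in> Y\<close>; nothing is required of it outside
  \<open>space \<Lambda>\<close>, \<open>X\<close> and \<open>Y\<close>.
  Measurement independence is the fact that the distribution \<open>\<Lambda>\<close> of the hidden variables is
  a single probability space, not indexed by the settings.
\<close>

locale mi_hv_model = prob_space \<Lambda>
  for \<Lambda> :: "'l measure" +
  fixes X :: "'x set" and Y :: "'y set"
    and P :: "'l \<Rightarrow> 'x \<Rightarrow> 'y \<Rightarrow> ('a::finite \<times> 'b::finite) pmf"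
  assumes measurable_P:
    "x \<in> X \<Longrightarrow> y \<in> Y \<Longrightarrow> (\<lambda>l. pmf (P l x y) (a, b)) \<in> borel_measurable \<Lambda>"

definition correlation ::
    "'l measure \<Rightarrow> ('l \<Rightarrow> 'x \<Rightarrow> 'y \<Rightarrow> ('a \<times> 'b) pmf) \<Rightarrow> 'a \<Rightarrow> 'b \<Rightarrow> 'x \<Rightarrow> 'y \<Rightarrow> real" where
  "correlation \<Lambda> P a b x y = (\<integral>l. pmf (P l x y) (a, b) \<partial>\<Lambda>)"

definition marginal_A :: "('a \<times> 'b::finite) pmf \<Rightarrow> 'a \<Rightarrow> real" where
  "marginal_A D a = (\<Sum>b\<in>UNIV. pmf D (a, b))"

definition marginal_B :: "('a::finite \<times> 'b) pmf \<Rightarrow> 'b \<Rightarrow> real" where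
  "marginal_B D b = (\<Sum>a\<in>UNIV. pmf D (a, b))"

definition parameter_independent ::
    "'l measure \<Rightarrow> 'x set \<Rightarrow> 'y set \<Rightarrow> ('l \<Rightarrow> 'x \<Rightarrow> 'y \<Rightarrow> ('a::finite \<times> 'b::finite) pmf) \<Rightarrow> bool" where
  "parameter_independent \<Lambda> X Y P \<longleftrightarrow>
     (\<forall>l\<in>space \<Lambda>.
        (\<forall>x\<in>X. \<forall>y\<in>Y. \<forall>y'\<in>Y. \<forall>a. marginal_A (P l x y) a = marginal_A (P l x y') a) \<and>
        (\<forall>x\<in>X. \<forall>x'\<in>X. \<forall>y\<in>Y. \<forall>b. marginal_B (P l x y) b = marginal_B (P l x' y) b))"

definition cond_B :: "('a \<times> 'b::finite) pmf \<Rightarrow> 'a \<Rightarrow> 'b \<Rightarrow> real" where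
  "cond_B D a b = pmf D (a, b) / marginal_A D a"

definition outcome_dependent ::
    "real \<Rightarrow> 'l measure \<Rightarrow> 'x set \<Rightarrow> 'y set \<Rightarrow> ('l \<Rightarrow> 'x \<Rightarrow> 'y \<Rightarrow> ('a \<times> 'b::finite) pmf) \<Rightarrow> bool" where
  "outcome_dependent \<delta> \<Lambda> X Y P \<longleftrightarrow>
     (\<forall>l\<in>space \<Lambda>. \<forall>x\<in>X. \<forall>y\<in>Y. \<forall>a a'.
        marginal_A (P l x y) a > 0 \<longrightarrow> marginal_A (P l x y) a' > 0 \<longrightarrow>
        (1/2) * (\<Sum>b\<in>UNIV. \<bar>cond_B (P l x y) a b - cond_B (P l x y) a' b\<bar>) \<le> \<delta>)"

end

theory Submission
  imports Defs
begin

text \<open>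
  Fix a hidden variable and let \<open>\<alpha> x\<close>, \<open>\<beta> y\<close> be the
  probabilities that Alice, resp. Bob, outputs 0. The vanishing correlations give
  \<open>\<alpha> (k+1) \<le> \<beta> k\<close> and \<open>\<beta> (k+1) \<le> \<alpha> k\<close>, so there are two decreasing chains,
  one starting at \<open>\<alpha> 0\<close> and one at \<open>\<beta> 0\<close>. Bounded outcome dependence gains a factor
  \<open>\<delta>\<close> at every step from \<open>\<alpha> k\<close> to \<open>\<beta> (k+1)\<close> with \<open>\<alpha> k < 1\<close>,
  and moreover \<open>\<beta> 0 \<le> \<delta> (1 - \<alpha> 0)\<close>. One chain ends in \<open>\<alpha> M\<close>, the other in
  \<open>\<beta> M\<close>, and both bound \<open>p(0,0|M,M)\<close>; balancing the two bounds over
  \<open>\<alpha> 0\<close> gives the claim pointwise.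
\<close>

lemma UNIV_2_eq: "(UNIV :: 2 set) = {0, 1}"
proof -
  have "x \<in> {0, 1}" for x :: 2
    using exhaust_2[of x] by auto
  then show ?thesis by blast
qed

lemma marginal_A_2: "marginal_A (D :: ('a \<times> 2) pmf) a = pmf D (a, 0) + pmf D (a, 1)"
  unfolding marginal_A_def UNIV_2_eq by simp

lemma marginal_B_2: "marginal_B (D :: (2 \<times> 'b) pmf) b = pmf D (0, b) + pmf D (1, b)"
  unfolding marginal_B_def UNIV_2_eq by simp

lemma pmf_2_2_sum:
  fixes D :: "(2 \<times> 2) pmf"
  shows "pmf D (0, 0) + pmf D (0, 1) + pmf D (1, 0) + pmf D (1, 1) = 1"
proof -
  have "sum (pmf D) UNIV = 1"
    by (intro sum_pmf_eq_1) auto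
  moreover have "(UNIV :: (2 \<times> 2) set) = {(0, 0), (0, 1), (1, 0), (1, 1)}"
    unfolding UNIV_Times_UNIV[symmetric] UNIV_2_eq by auto
  ultimately have "sum (pmf D) {(0, 0), (0, 1), (1, 0), (1, 1)} = 1"
    by metis
  then show ?thesis by simp
qed

text \<open>With only two values of \<open>b\<close>, the two differences of conditional
  probabilities are opposite numbers, so the total variation distance is the absolute value of
  either one.\<close>

lemma cond_B_diff_le:
  fixes D :: "(2 \<times> 2) pmf"
  assumes OD: "\<forall>a a'. marginal_A D a > 0 \<longrightarrow> marginal_A D a' > 0 \<longrightarrow>
      (1/2) * (\<Sum>b\<in>UNIV. \<bar>cond_B D a b - cond_B D a' b\<bar>) \<le> \<delta>"
    and pos: "0 < marginal_A D a" "0 < marginal_A D a'"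
  shows "cond_B D a 0 - cond_B D a' 0 \<le> \<delta>"
proof -
  have sum1: "cond_B D c 0 + cond_B D c 1 = 1" if "0 < marginal_A D c" for c
    using that unfolding cond_B_def
    by (simp add: add_divide_distrib[symmetric] marginal_A_2[symmetric])
  define d where "d = cond_B D a 0 - cond_B D a' 0"
  have "cond_B D a 1 - cond_B D a' 1 = - d"
    using sum1[OF pos(1)] sum1[OF pos(2)] unfolding d_def by linarith
  then have "(1/2) * (\<bar>d\<bar> + \<bar>- d\<bar>) \<le> \<delta>"
    using OD[rule_format, OF pos] unfolding UNIV_2_eq by (simp add: d_def[symmetric])
  then show ?thesis by (simp add: d_def[symmetric])
qed

text \<open>Given \<open>a'\<close>, Bob's outcome 0 has conditional probability 0, hence given
  \<open>a\<close> it has at most \<delta>; and all mass of Bob's 0 sits at \<open>a\<close>.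
  Positivity for \<open>a'\<close> makes the comparison of the two conditionals available.\<close>

lemma marginal_B_le_mult_marginal_A:
  fixes D :: "(2 \<times> 2) pmf"
  assumes OD: "\<forall>a a'. marginal_A D a > 0 \<longrightarrow> marginal_A D a' > 0 \<longrightarrow>
      (1/2) * (\<Sum>b\<in>UNIV. \<bar>cond_B D a b - cond_B D a' b\<bar>) \<le> \<delta>"
    and zero: "pmf D (a', 0) = 0" and aa': "{a, a'} = {0, 1}"
    and pos: "0 < marginal_A D a'"
  shows "marginal_B D 0 \<le> \<delta> * marginal_A D a"
proof -
  have B: "marginal_B D 0 = pmf D (a, 0)"
    using zero aa' by (auto simp: marginal_B_2 doubleton_eq_iff)
  show ?thesis
  proof (cases "0 < marginal_A D a")
    case True
    from cond_B_diff_le[OF OD True pos] zero have "pmf D (a, 0) / marginal_A D a \<le> \<delta>"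
      by (simp add: cond_B_def)
    with True B show ?thesis by (simp add: field_simps)
  next
    case False
    then have "marginal_A D a = 0" "pmf D (a, 0) = 0"
      using pmf_nonneg[of D "(a, 0)"] pmf_nonneg[of D "(a, 1)"]
      unfolding marginal_A_2 by linarith+
    with B show ?thesis by simp
  qed
qed

text \<open>The increasing bound \<open>x\<close> and the decreasing bound
  \<open>s\<^sup>2 * (1 - x)\<close> cross at the value \<open>s\<^sup>2 / (1 + s\<^sup>2)\<close>,
  which is at most \<open>s / 2\<close> because \<open>(s - 1)\<^sup>2\<close> is
  nonnegative.\<close>

lemma min_balanced_le:
  fixes s x y :: real
  assumes "0 \<le> s" and y: "y \<le> s\<^sup>2 * (1 - x)"
  shows "min x y \<le> s / 2"
proof (rule ccontr)
  assume "\<not> min x y \<le> s / 2"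
  then have x: "s / 2 < x" and "s / 2 < s\<^sup>2 * (1 - x)"
    using y by auto
  then have "0 < s" using \<open>0 \<le> s\<close> by (cases "s = 0") auto
  moreover have "s * (1 / 2) < s * (s * (1 - x))"
    using \<open>s / 2 < s\<^sup>2 * (1 - x)\<close> by (simp add: power2_eq_square mult.assoc)
  ultimately have "1 / 2 < s * (1 - x)"
    using mult_less_cancel_left_pos by blast
  also have "\<dots> \<le> s * (1 - s / 2)"
    using x \<open>0 < s\<close> by (intro mult_left_mono) auto
  finally show False
    using zero_le_power2[of "s - 1"] by (simp add: power2_eq_square algebra_simps)
qed

text \<open>Only steps from \<alpha> to \<beta> gain a factor, since outcome dependence conditions
  on Alice's outcome. The alternative \<open>\<alpha> 0 = 0\<close> and the condition
  \<open>\<alpha> k < 1\<close> reflect that conditioning on her outcome 0, respectively 1, needs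
  positive probability.\<close>

lemma interleaved_chains_bound:
  fixes \<alpha> \<beta> :: "nat \<Rightarrow> real" and \<delta> :: real
  assumes \<delta>: "0 \<le> \<delta>" "\<delta> \<le> 1"
    and \<alpha>0: "\<And>k. k \<le> M \<Longrightarrow> 0 \<le> \<alpha> k"
    and \<beta>0: "\<And>k. k \<le> M \<Longrightarrow> 0 \<le> \<beta> k"
    and start: "\<alpha> 0 + \<beta> 0 \<le> 1" "\<alpha> 0 = 0 \<or> \<beta> 0 \<le> \<delta> * (1 - \<alpha> 0)"
    and \<alpha>\<beta>: "\<And>k. k < M \<Longrightarrow> \<alpha> (Suc k) \<le> \<beta> k"
    and \<beta>\<alpha>: "\<And>k. k < M \<Longrightarrow> \<beta> (Suc k) \<le> \<alpha> k"
    and \<beta>\<alpha>': "\<And>k. k < M \<Longrightarrow> \<alpha> k < 1 \<Longrightarrow> \<beta> (Suc k) \<le> \<delta> * \<alpha> k"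
  shows "min (\<alpha> M) (\<beta> M) \<le> sqrt \<delta> ^ Suc M / 2"
proof -
  \<comment> \<open>The chain \<open>\<alpha> 0\<close>, \<open>\<beta> 1\<close>,
    \<open>\<alpha> 2\<close>, ... gains at steps 1, 3, 5, ...; the chain \<open>\<beta> 0\<close>,
    \<open>\<alpha> 1\<close>, \<open>\<beta> 2\<close>, ... gains at steps 2, 4, 6, .... At odd
    \<open>k\<close> the first is one factor ahead.\<close>
  define I where "I k \<longleftrightarrow> (if even k
      then \<alpha> k \<le> \<delta> ^ (k div 2) * \<alpha> 0 \<and> \<beta> k \<le> \<delta> ^ (k div 2) * \<beta> 0
      else \<beta> k \<le> \<delta> ^ Suc (k div 2) * \<alpha> 0 \<and> \<alpha> k \<le> \<delta> ^ (k div 2) * \<beta> 0)" for k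
  have pw: "\<delta> ^ n * x \<le> x" if "0 \<le> x" for n x
    using power_le_one[OF \<delta>] mult_right_mono[OF _ that, of "\<delta> ^ n" 1] by simp
  \<comment> \<open>The invariant can break only at a step with \<open>\<alpha> k \<ge> 1\<close>.
    The zero alternatives absorb this: a zero is passed along its chain and makes the final minimum
    0.\<close>
  have inv: "\<alpha> k = 0 \<or> \<beta> k = 0 \<or> I k" if "k \<le> M" for k
    using that
  proof (induction k)
    case 0
    then show ?case by (simp add: I_def)
  next
    case (Suc k)
    then have kM: "k < M" "k \<le> M" by auto
    note nn = \<alpha>0[OF kM(2)] \<beta>0[OF kM(2)] \<alpha>0[OF Suc.prems] \<beta>0[OF Suc.prems]
      \<alpha>\<beta>[OF kM(1)] \<beta>\<alpha>[OF kM(1)]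
    consider "\<alpha> k = 0 \<or> \<beta> k = 0" | "\<alpha> k < 1" "I k" | "\<alpha> k \<ge> 1" "I k"
      using Suc.IH kM by linarith
    then show ?case
    proof cases
      case 1
      then show ?thesis using nn by auto
    next
      case 2
      have b: "\<beta> (Suc k) \<le> \<delta> * \<alpha> k" using \<beta>\<alpha>'[OF kM(1) 2(1)] .
      have "I (Suc k)"
      proof (cases "even k")
        case True
        then have "\<alpha> k \<le> \<delta> ^ (k div 2) * \<alpha> 0" "\<beta> k \<le> \<delta> ^ (k div 2) * \<beta> 0"
          using 2(2) by (auto simp: I_def)
        with b nn mult_left_mono[OF this(1) \<delta>(1)] True show ?thesis
          by (auto simp: I_def mult.assoc)
      next
        case False
        then have "\<alpha> k \<le> \<delta> ^ (k div 2) * \<beta> 0" "\<beta> k \<le> \<delta> ^ Suc (k div 2) * \<alpha> 0"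
          using 2(2) by (auto simp: I_def)
        with b nn mult_left_mono[OF this(1) \<delta>(1)] False show ?thesis
          by (auto simp: I_def mult.assoc)
      qed
      then show ?thesis by simp
    next
      \<comment> \<open>The whole chain of \<open>\<alpha> k\<close> is 1, and then the other chain vanishes.\<close>
      case 3
      have "\<alpha> k = 0 \<or> \<beta> k = 0"
      proof (cases "even k")
        case True
        then have "\<alpha> 0 \<ge> 1" "\<beta> k \<le> \<delta> ^ (k div 2) * \<beta> 0"
          using 3 pw[of "\<alpha> 0" "k div 2"] \<alpha>0[of 0] by (auto simp: I_def)
        moreover from this have "\<beta> 0 = 0" using start(1) \<beta>0[of 0] by auto
        ultimately show ?thesis using nn by auto
      next
        case False
        then have "\<beta> 0 \<ge> 1" "\<beta> k \<le> \<delta> ^ Suc (k div 2) * \<alpha> 0"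
          using 3 pw[of "\<beta> 0" "k div 2"] \<beta>0[of 0] by (auto simp: I_def)
        moreover from this have "\<alpha> 0 = 0" using start(1) \<alpha>0[of 0] by auto
        ultimately show ?thesis using nn by auto
      qed
      then show ?thesis using nn by auto
    qed
  qed
  \<comment> \<open>The square root turns the half-integer exponent into the natural power
    \<open>s ^ Suc M\<close>.\<close>
  define s where "s = sqrt \<delta>"
  have s: "0 \<le> s" "\<delta> = s\<^sup>2" using \<delta> by (auto simp: s_def)
  consider "\<alpha> M = 0 \<or> \<beta> M = 0" | "\<alpha> 0 = 0" "I M" | "\<beta> 0 \<le> \<delta> * (1 - \<alpha> 0)" "I M"
    using inv[of M] start(2) by auto
  then have "min (\<alpha> M) (\<beta> M) \<le> s ^ Suc M / 2"
  proof cases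
    case 1
    then have "min (\<alpha> M) (\<beta> M) \<le> 0" by auto
    also have "0 \<le> s ^ Suc M / 2" using s(1) by simp
    finally show ?thesis .
  next
    case 2
    then have "min (\<alpha> M) (\<beta> M) \<le> 0" by (auto simp: I_def split: if_splits)
    also have "0 \<le> s ^ Suc M / 2" using s(1) by simp
    finally show ?thesis .
  next
    case 3
    show ?thesis
    proof (cases "even M")
      \<comment> \<open>Both chains carry the same factor \<open>s ^ M\<close>; the missing
        \<open>s / 2\<close> comes from balancing their starting values.\<close>
      case True
      then have eq: "\<delta> ^ (M div 2) = s ^ M"
        unfolding s(2) power_mult[symmetric] by simp
      have "min (\<alpha> M) (\<beta> M) \<le> min (s ^ M * \<alpha> 0) (s ^ M * \<beta> 0)"
        using 3(2) True unfolding I_def eq by auto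
      also have "\<dots> = s ^ M * min (\<alpha> 0) (\<beta> 0)"
        using s(1) by (simp add: min_mult_distrib_left)
      also have "\<dots> \<le> s ^ M * (s / 2)"
        using min_balanced_le[OF s(1), of "\<beta> 0" "\<alpha> 0"] 3(1) s by (intro mult_left_mono) auto
      finally show ?thesis by (simp add: mult.commute)
    next
      \<comment> \<open>Here the bound on \<beta> 0 supplies the lagging factor, so the two end
        values sum to at most \<open>s ^ Suc M\<close> and the smaller is at most half of
        it.\<close>
      case False
      then have "2 * Suc (M div 2) = Suc M" by presburger
      then have eq: "\<delta> ^ Suc (M div 2) = s ^ Suc M"
        unfolding s(2) power_mult[symmetric] by simp
      have "\<alpha> M \<le> \<delta> ^ (M div 2) * \<beta> 0" "\<beta> M \<le> s ^ Suc M * \<alpha> 0"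
        using 3(2) False unfolding I_def eq by auto
      moreover have "\<delta> ^ (M div 2) * \<beta> 0 \<le> \<delta> ^ (M div 2) * (\<delta> * (1 - \<alpha> 0))"
        using 3(1) \<delta>(1) by (intro mult_left_mono) auto
      moreover have "\<dots> = s ^ Suc M * (1 - \<alpha> 0)"
        unfolding eq[symmetric] by simp
      ultimately have "\<alpha> M + \<beta> M \<le> s ^ Suc M"
        by (simp add: right_diff_distrib)
      then show ?thesis by auto
    qed
  qed
  then show ?thesis by (simp add: s_def)
qed

text \<open>A nonnegative integrand with integral 0 vanishes almost everywhere. Integrability has to
  be shown first, because the integral of a non-integrable function is 0 by default.\<close>

lemma (in mi_hv_model) correlation_eq_0_AE:
  assumes "x \<in> X" "y \<in> Y" "correlation \<Lambda> P a b x y = 0"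
  shows "AE l in \<Lambda>. pmf (P l x y) (a, b) = 0"
proof -
  have "integrable \<Lambda> (\<lambda>l. pmf (P l x y) (a, b))"
    using measurable_P[OF assms(1,2)] by (intro integrable_const_bound[of _ 1]) (auto simp: pmf_le_1)
  then show ?thesis
    using assms(3) integral_nonneg_eq_0_iff_AE[of \<Lambda> "\<lambda>l. pmf (P l x y) (a, b)"]
    by (simp add: correlation_def)
qed

theorem mainTheorem2:
  fixes M :: nat and \<delta> :: real
    and \<Lambda> :: "'l measure"
    and P :: "'l \<Rightarrow> nat \<Rightarrow> nat \<Rightarrow> (2 \<times> 2) pmf"
  assumes "M \<ge> 1"
    and "0 \<le> \<delta>" and "\<delta> \<le> 1"
    and "mi_hv_model \<Lambda> {0..M} {0..M} P"
    and "parameter_independent \<Lambda> {0..M} {0..M} P"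
    and "outcome_dependent \<delta> \<Lambda> {0..M} {0..M} P"
    and "correlation \<Lambda> P 0 0 0 0 = 0"
    and "\<And>k. k \<in> {1..M} \<Longrightarrow> correlation \<Lambda> P 0 1 k (k - 1) = 0"
    and "\<And>k. k \<in> {1..M} \<Longrightarrow> correlation \<Lambda> P 1 0 (k - 1) k = 0"
  shows "correlation \<Lambda> P 0 0 M M \<le> \<delta> powr ((real M + 1) / 2) / 2"
proof -
  interpret mi_hv_model \<Lambda> "{0..M}" "{0..M}" P by fact
  define c where "c = sqrt \<delta> ^ Suc M / 2"
  have bound: "pmf (P l M M) (0, 0) \<le> c"
    if l: "l \<in> space \<Lambda>" and z0: "pmf (P l 0 0) (0, 0) = 0"
      and z01: "\<forall>k\<in>{1..M}. pmf (P l k (k - 1)) (0, 1) = 0"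
      and z10: "\<forall>k\<in>{1..M}. pmf (P l (k - 1) k) (1, 0) = 0" for l
  proof -
    \<comment> \<open>The remote setting 0 is an arbitrary reference; parameter independence allows
      any other.\<close>
    define \<alpha> where "\<alpha> k = marginal_A (P l k 0) 0" for k
    define \<beta> where "\<beta> k = marginal_B (P l 0 k) 0" for k
    have \<alpha>: "marginal_A (P l x y) 0 = \<alpha> x" if "x \<in> {0..M}" "y \<in> {0..M}" for x y
      using assms(5) l that unfolding parameter_independent_def \<alpha>_def by (meson atLeastAtMost_iff le0)
    have \<beta>: "marginal_B (P l x y) 0 = \<beta> y" if "x \<in> {0..M}" "y \<in> {0..M}" for x y
      using assms(5) l that unfolding parameter_independent_def \<beta>_def by (meson atLeastAtMost_iff le0)
    have \<alpha>1: "marginal_A (P l x y) 1 = 1 - \<alpha> x" if "x \<in> {0..M}" "y \<in> {0..M}" for x y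
      using \<alpha>[OF that] pmf_2_2_sum[of "P l x y"] unfolding marginal_A_2 by linarith
    have OD: "\<forall>a a'. marginal_A (P l x y) a > 0 \<longrightarrow> marginal_A (P l x y) a' > 0 \<longrightarrow>
      (1/2) * (\<Sum>b\<in>UNIV. \<bar>cond_B (P l x y) a b - cond_B (P l x y) a' b\<bar>) \<le> \<delta>"
      if "x \<in> {0..M}" "y \<in> {0..M}" for x y
      using assms(6) l that unfolding outcome_dependent_def by blast
    have mem: "0 \<in> {0..M}" "M \<in> {0..M}" by auto
    have "pmf (P l M M) (0, 0) \<le> min (\<alpha> M) (\<beta> M)"
      using \<alpha>[OF mem(2,2)] \<beta>[OF mem(2,2)] pmf_nonneg[of "P l M M" "(0, 1)"]
        pmf_nonneg[of "P l M M" "(1, 0)"]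
      unfolding marginal_A_2 marginal_B_2 by linarith
    also have "\<dots> \<le> sqrt \<delta> ^ Suc M / 2"
    proof (rule interleaved_chains_bound[OF assms(2,3)])
      show "0 \<le> \<alpha> k" "0 \<le> \<beta> k" for k
        by (simp_all add: \<alpha>_def \<beta>_def marginal_A_2 marginal_B_2)
      show "\<alpha> 0 + \<beta> 0 \<le> 1"
        using z0 pmf_2_2_sum[of "P l 0 0"] pmf_nonneg[of "P l 0 0" "(1, 1)"]
        unfolding \<alpha>_def \<beta>_def marginal_A_2 marginal_B_2 by linarith
      show "\<alpha> 0 = 0 \<or> \<beta> 0 \<le> \<delta> * (1 - \<alpha> 0)"
      proof (cases "\<alpha> 0 = 0")
        case False
        with \<open>0 \<le> \<alpha> 0\<close> have "0 < marginal_A (P l 0 0) 0" by (simp add: \<alpha>_def)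
        \<comment> \<open>At settings (0, 0) Alice's 0 excludes Bob's 0, so the mass of Bob's 0 sits
          at her outcome 1, of weight \<open>1 - \<alpha> 0\<close>.\<close>
        from marginal_B_le_mult_marginal_A[OF OD[OF mem(1,1)] z0 _ this, of 1]
        show ?thesis by (auto simp: \<alpha>1[OF mem(1,1)] \<beta>[OF mem(1,1)])
      qed simp
    next
      fix k assume k: "k < M"
      then have mem: "k \<in> {0..M}" "Suc k \<in> {0..M}" by auto
      have z1: "pmf (P l (Suc k) k) (0, 1) = 0"
        using z01[rule_format, of "Suc k"] k by simp
      show "\<alpha> (Suc k) \<le> \<beta> k"
        using \<alpha>[OF mem(2,1)] \<beta>[OF mem(2,1)] z1 pmf_nonneg[of "P l (Suc k) k" "(1, 0)"]
        unfolding marginal_A_2 marginal_B_2 by linarith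
      have z2: "pmf (P l k (Suc k)) (1, 0) = 0"
        using z10[rule_format, of "Suc k"] k by simp
      show "\<beta> (Suc k) \<le> \<alpha> k"
        using \<alpha>[OF mem] \<beta>[OF mem] z2 pmf_nonneg[of "P l k (Suc k)" "(0, 1)"]
        unfolding marginal_A_2 marginal_B_2 by linarith
      assume "\<alpha> k < 1"
      then have "0 < marginal_A (P l k (Suc k)) 1" using \<alpha>1[OF mem] by simp
      \<comment> \<open>Now the roles are reversed: Alice's 1 excludes Bob's 0.\<close>
      from marginal_B_le_mult_marginal_A[OF OD[OF mem] z2 _ this, of 0]
      show "\<beta> (Suc k) \<le> \<delta> * \<alpha> k" by (auto simp: \<alpha>[OF mem] \<beta>[OF mem])
    qed
    finally show ?thesis by (simp add: c_def)
  qed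
  have "AE l in \<Lambda>. pmf (P l 0 0) (0, 0) = 0"
    by (rule correlation_eq_0_AE[OF _ _ assms(7)]) simp_all
  \<comment> \<open>Finitely many \<open>k\<close>, so the exceptional null sets can be
    united.\<close>
  moreover have "AE l in \<Lambda>. \<forall>k\<in>{1..M}. pmf (P l k (k - 1)) (0, 1) = 0"
    by (intro AE_finite_allI correlation_eq_0_AE assms(8)) auto
  moreover have "AE l in \<Lambda>. \<forall>k\<in>{1..M}. pmf (P l (k - 1) k) (1, 0) = 0"
    by (intro AE_finite_allI correlation_eq_0_AE assms(9)) auto
  ultimately have "AE l in \<Lambda>. pmf (P l M M) (0, 0) \<le> c"
    using AE_space[of \<Lambda>] by eventually_elim (rule bound)
  moreover have "integrable \<Lambda> (\<lambda>l. pmf (P l M M) (0, 0))"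
    by (intro integrable_const_bound[of _ 1] measurable_P) (auto simp: pmf_le_1)
  ultimately have "correlation \<Lambda> P 0 0 M M \<le> c"
    unfolding correlation_def by (intro integral_le_const)
  also have "c = \<delta> powr ((real M + 1) / 2) / 2"
  \<comment> \<open>Rewriting \<open>powr\<close> with a natural exponent needs a positive base; at
    \<delta> = 0 both sides are 0.\<close>
  proof (cases "\<delta> = 0")
    case False
    then have "sqrt \<delta> ^ Suc M = (\<delta> powr (1 / 2)) powr real (Suc M)"
      using \<open>0 \<le> \<delta>\<close> by (subst powr_realpow) (auto simp: powr_half_sqrt)
    then show ?thesis by (simp add: c_def powr_powr add.commute)
  qed (simp add: c_def)
  finally show ?thesis .
qed

end
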